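(* Let $X$ be a $T_1$ regular topological space. If $X$ is compact and scattered with dispersion index $i(X)\leq 3$, then $X$ is an $s$-$m_1$-space.
   Context: A family $\mathcal{P}$ of subsets of a space $X$ is closure-preserving if for every subfamily $\mathcal{P}'\subset\mathcal{P}$ we have $\overline{\bigcup\mathcal{P}'}=\bigcup\{\overline{P}: P\in\mathcal{P}'\}$. A family $\mathcal{A}$ of open subsets of $X$ is a base of $X$ at a set $A\subset X$ if $A=\bigcap\mathcal{A}$ and for every neighborhood $U$ of $A$ there is $V\in\mathcal{A}$ with $A\subset V\subset U$. $X$ is $s$-$m_1$ at a closed set $F$ if $X$ has a closure-preserving base at $F$. $X$ is an $s$-$m_1$-space if it is $s$-$m_1$ at every closed subset. Dispersion index: for a space $Z$ let $I(Z)$ be the set of isolated points of $Z$. For a scattered space $X$ put $X_0=X$, $X_{\beta+1}=X_\beta\setminus I(X_\beta)$, and $X_\alpha=\bigcap\{X_\beta:\beta<\alpha\}$ for limit ordinals $\alpha$. Then $i(X)$ is the first ordinal $\alpha$ such that $X_\alpha=\emptyset$. *)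

theory Defs
  imports "HOL-Analysis.Analysis"
begin

definition closure_preserving :: "'a topology \<Rightarrow> 'a set set \<Rightarrow> bool"
  where "closure_preserving X \<P> \<longleftrightarrow>
    (\<forall>\<P>' \<subseteq> \<P>. X closure_of (\<Union>\<P>') = (\<Union>P\<in>\<P>'. X closure_of P))"

definition neighborhood_of_set :: "'a topology \<Rightarrow> 'a set \<Rightarrow> 'a set \<Rightarrow> bool"
  where "neighborhood_of_set X A U \<longleftrightarrow>
    U \<subseteq> topspace X \<and> (\<exists>W. openin X W \<and> A \<subseteq> W \<and> W \<subseteq> U)"

definition base_at_set :: "'a topology \<Rightarrow> 'a set \<Rightarrow> 'a set set \<Rightarrow> bool"
  where "base_at_set X A \<A> \<longleftrightarrow>
    (\<forall>V\<in>\<A>. openin X V) \<and> A = \<Inter>\<A> \<and>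
    (\<forall>U. neighborhood_of_set X A U \<longrightarrow> (\<exists>V\<in>\<A>. A \<subseteq> V \<and> V \<subseteq> U))"

definition s_m1_at :: "'a topology \<Rightarrow> 'a set \<Rightarrow> bool"
  where "s_m1_at X F \<longleftrightarrow> (\<exists>\<A>. base_at_set X F \<A> \<and> closure_preserving X \<A>)"

definition s_m1_space :: "'a topology \<Rightarrow> bool"
  where "s_m1_space X \<longleftrightarrow> (\<forall>F. closedin X F \<longrightarrow> s_m1_at X F)"

definition isolated_points :: "'a topology \<Rightarrow> 'a set"
  where "isolated_points Z = {x \<in> topspace Z. openin Z {x}}"

definition scattered_space :: "'a topology \<Rightarrow> bool"
  where "scattered_space X \<longleftrightarrow>
    (\<forall>S \<subseteq> topspace X. S \<noteq> {} \<longrightarrow> isolated_points (subtopology X S) \<noteq> {})"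

text \<open>
  Ordinals are represented, as in the library, by well-order relations (reflexive on their field),
  compared by \<^term>\<open>ordLeq\<close> and \<^term>\<open>ordLess\<close>. The ordinals below the order type of a well-order
  \<open>r\<close> are the order types of its proper initial segments \<open>segment_below r a\<close> for
  \<open>a \<in> Field r\<close>, and \<open>r\<close> is a successor iff it has a greatest element \<open>m\<close>;
  its predecessor is then \<open>segment_below r m\<close>.
\<close>

definition segment_below :: "'o rel \<Rightarrow> 'o \<Rightarrow> 'o rel"
  where "segment_below r a = Restr r (underS r a)"

definition greatest_in :: "'o rel \<Rightarrow> 'o \<Rightarrow> bool"
  where "greatest_in r m \<longleftrightarrow> m \<in> Field r \<and> (\<forall>a\<in>Field r. (a, m) \<in> r)"

lemma segment_below_ordLess:
  "Well_order r \<Longrightarrow> a \<in> Field r \<Longrightarrow> (segment_below r a, r) \<in> ordLess"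
  unfolding segment_below_def by (rule underS_Restr_ordLess) auto

lemma greatest_in_the:
  assumes "Well_order r" "greatest_in r m"
  shows "(THE m. greatest_in r m) = m"
proof (rule the_equality)
  fix m' assume "greatest_in r m'"
  with assms show "m' = m"
    unfolding greatest_in_def well_order_on_def linear_order_on_def partial_order_on_def
    by (auto dest: antisymD)
qed (rule assms)

text \<open>
  \<open>cb_derivative X r\<close> is the set \<open>X\<^sub>\<alpha>\<close> for \<open>\<alpha>\<close> the order type of \<open>r\<close>. Relations that are not
  well-orders represent no ordinal, and the value there is irrelevant.
\<close>

function cb_derivative :: "'a topology \<Rightarrow> 'o rel \<Rightarrow> 'a set"
  where "cb_derivative X r =
    (if \<not> Well_order r then undefined
     else if Field r = {} then topspace X
     else if \<exists>m. greatest_in r m then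
       (let Z = cb_derivative X (segment_below r (THE m. greatest_in r m))
        in Z - isolated_points (subtopology X Z))
     else (\<Inter>a\<in>Field r. cb_derivative X (segment_below r a)))"
  by pat_completeness auto
termination
proof (relation "inv_image ordLess snd")
  show "wf (inv_image ordLess (snd :: 'a topology \<times> 'o rel \<Rightarrow> 'o rel))"
    by (intro wf_inv_image wf_ordLess)
next
  fix X :: "'a topology" and r :: "'o rel"
  assume "\<not> \<not> Well_order r" "\<exists>m. greatest_in r m"
  then show "((X, segment_below r (THE m. greatest_in r m)), (X, r)) \<in> inv_image ordLess snd"
    using greatest_in_the[of r] segment_below_ordLess[of r]
    by (auto simp: greatest_in_def)
next
  fix X :: "'a topology" and r :: "'o rel" and a
  assume "\<not> \<not> Well_order r" "a \<in> Field r"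
  then show "((X, segment_below r a), (X, r)) \<in> inv_image ordLess snd"
    using segment_below_ordLess[of r a] by simp
qed

declare cb_derivative.simps [simp del]

definition is_dispersion_index :: "'a topology \<Rightarrow> 'o rel \<Rightarrow> bool"
  where "is_dispersion_index X r \<longleftrightarrow>
    Well_order r \<and> cb_derivative X r = {} \<and>
    (\<forall>r' :: 'o rel. (r', r) \<in> ordLess \<longrightarrow> cb_derivative X r' \<noteq> {})"

end

theory Submission
  imports Defs
begin

text \<open>
  Let \<open>F\<close> be closed and \<open>X\<^sub>3 = {}\<close>. A compact Hausdorff scattered space has only trivial connected
  subsets, so disjoint closed sets are separated by clopen sets
  (\<open>clopen_between_if_compact_scattered\<close>). As \<open>X\<^sub>2\<close> is closed and discrete, \<open>X\<^sub>2 - F\<close> is closed,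
  and there is a clopen \<open>V \<supseteq> F\<close> that contains no point of \<open>X\<^sub>2\<close> outside \<open>F\<close>.

  Every \<open>x \<in> V - F\<close> is then isolated in \<open>X\<close> or in \<open>X\<^sub>1\<close>, so it has a clopen neighbourhood \<open>U\<^sub>x\<close>
  that misses \<open>F\<close> and meets \<open>X\<^sub>1\<close> at most in \<open>x\<close>. The base at \<open>F\<close> consists of the sets \<open>V\<close> minus
  finitely many of the \<open>U\<^sub>x\<close>. By compactness it is a base. All its members are clopen, so it is
  closure-preserving as soon as unions of members are closed, that is, as soon as the finite unions
  of the \<open>U\<^sub>x\<close> have open intersections. For this it suffices that each point \<open>y\<close> has one
  neighbourhood contained in every \<open>U\<^sub>x\<close> that contains \<open>y\<close>
  (\<open>s_m1_at_if_interior_preserving_cover\<close>). If \<open>y\<close> is isolated, \<open>{y}\<close> is such a neighbourhood. If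
  \<open>y \<in> X\<^sub>1\<close>, then \<open>y \<in> U\<^sub>x\<close> forces \<open>x = y\<close>, so at most one of the chosen sets contains \<open>y\<close>. Choosing
  a single \<open>U\<^sub>x\<close> for each \<open>x\<close> is what makes this work.
\<close>

section \<open>Clopen separation in compact scattered spaces\<close>

lemma scattered_connectedin_singleton:
  assumes "t1_space X" "scattered_space X" "connectedin X C" "C \<noteq> {}"
  obtains c where "C = {c}"
proof -
  have C: "C \<subseteq> topspace X"
    using assms(3) by (rule connectedin_subset_topspace)
  with assms(2,4) have "isolated_points (subtopology X C) \<noteq> {}"
    unfolding scattered_space_def by blast
  then obtain c where c: "c \<in> C" "openin (subtopology X C) {c}"
    unfolding isolated_points_def by auto
  have "closedin (subtopology X C) {c}"
    using assms(1) C c(1) by (simp add: closedin_t1_singleton t1_space_subtopology in_mono)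
  moreover have "connected_space (subtopology X C)"
    using assms(3) by (simp add: connectedin_def)
  ultimately have "{c} = topspace (subtopology X C)"
    using c(2) unfolding connected_space_clopen_in by blast
  with C have "C = {c}"
    by auto
  then show thesis
    by (rule that)
qed

text \<open>
  In a compact Hausdorff space two closed sets that no connected set joins are separated by a
  clopen set, and scatteredness leaves no connected set that could join disjoint sets.
\<close>

lemma clopen_between_if_compact_scattered:
  assumes "compact_space X" "Hausdorff_space X" "scattered_space X"
    and "closedin X F" "openin X W" "F \<subseteq> W"
  obtains V where "openin X V" "closedin X V" "F \<subseteq> V" "V \<subseteq> W"
proof -
  have "separated_between X F (topspace X - W)"
  proof (rule cut_wire_fence_theorem[OF assms(1,2,4)])
    show "closedin X (topspace X - W)"
      using assms(5) by blast
    fix C assume "connectedin X C"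
    then have "C = {} \<or> (\<exists>c. C = {c})"
      using scattered_connectedin_singleton[OF Hausdorff_imp_t1_space[OF assms(2)] assms(3)]
      by metis
    then show "disjnt C F \<or> disjnt C (topspace X - W)"
      using assms(6) by auto
  qed
  then obtain V where "closedin X V" "openin X V" "F \<subseteq> V" "topspace X - W \<subseteq> topspace X - V"
    unfolding separated_between by blast
  moreover from this have "V \<subseteq> W"
    using openin_subset by blast
  ultimately show thesis
    using that by blast
qed

section \<open>Closure-preserving bases from clopen covers of the complement\<close>

text \<open>
  The finite unions of members of \<open>\<U>\<close> are cofinal among the compact subsets of \<open>V - F\<close>, so their
  complements in \<open>V\<close> form a base at \<open>F\<close>. A point \<open>y\<close> of \<open>V\<close> outside some of these complements lies,
  for each of them, in some removed \<open>U \<in> \<U>\<close>, and the neighbourhood of \<open>y\<close> common to all such \<open>U\<close>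
  avoids all of these complements at once.
\<close>

lemma s_m1_at_if_interior_preserving_cover:
  assumes comp: "compact_space X"
    and V: "openin X V" "closedin X V" and F: "F \<subseteq> V"
    and clopen: "\<And>U. U \<in> \<U> \<Longrightarrow> openin X U \<and> closedin X U"
    and miss: "\<And>U. U \<in> \<U> \<Longrightarrow> U \<inter> F = {}"
    and cover: "V - F \<subseteq> \<Union>\<U>"
    and stable: "\<And>y. y \<in> V \<Longrightarrow> \<exists>N. openin X N \<and> y \<in> N \<and> (\<forall>U\<in>\<U>. y \<in> U \<longrightarrow> N \<subseteq> U)"
  shows "s_m1_at X F"
proof -
  define \<A> where "\<A> = {V - \<Union>\<S> |\<S>. finite \<S> \<and> \<S> \<subseteq> \<U>}"
  have A_clopen: "openin X P \<and> closedin X P" if "P \<in> \<A>" for P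
  proof -
    from that obtain \<S> where S: "finite \<S>" "\<S> \<subseteq> \<U>" "P = V - \<Union>\<S>"
      unfolding \<A>_def by blast
    have "openin X (\<Union>\<S>)" "closedin X (\<Union>\<S>)"
      using S clopen by (auto intro!: openin_Union closedin_Union)
    with S V show ?thesis
      by (simp add: openin_diff closedin_diff)
  qed
  have F_sub: "F \<subseteq> P" if "P \<in> \<A>" for P
    using that F miss unfolding \<A>_def by blast
  have "F = \<Inter>\<A>"
  proof
    show "F \<subseteq> \<Inter>\<A>"
      using F_sub by blast
    show "\<Inter>\<A> \<subseteq> F"
    proof
      fix x assume x: "x \<in> \<Inter>\<A>"
      have "V - \<Union>{} \<in> \<A>"
        unfolding \<A>_def by blast
      with x have "x \<in> V"
        by auto
      show "x \<in> F"
      proof (rule ccontr)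
        assume "x \<notin> F"
        with \<open>x \<in> V\<close> cover obtain U where U: "U \<in> \<U>" "x \<in> U"
          by blast
        then have "V - \<Union>{U} \<in> \<A>"
          unfolding \<A>_def by blast
        with x U show False
          by auto
      qed
    qed
  qed
  moreover have "\<exists>P\<in>\<A>. F \<subseteq> P \<and> P \<subseteq> N" if "neighborhood_of_set X F N" for N
  proof -
    from that obtain W where W: "openin X W" "F \<subseteq> W" "W \<subseteq> N"
      unfolding neighborhood_of_set_def by blast
    have "compactin X (V - W)"
      using comp V(2) W(1) by (intro closedin_compact_space closedin_diff)
    moreover have "V - W \<subseteq> \<Union>\<U>"
      using cover W(2) by blast
    ultimately obtain \<S> where S: "finite \<S>" "\<S> \<subseteq> \<U>" "V - W \<subseteq> \<Union>\<S>"
      unfolding compactin_def using clopen by meson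
    then have "V - \<Union>\<S> \<in> \<A>"
      unfolding \<A>_def by blast
    moreover have "V - \<Union>\<S> \<subseteq> N"
      using S(3) W(3) by blast
    ultimately show ?thesis
      using F_sub by blast
  qed
  ultimately have "base_at_set X F \<A>"
    unfolding base_at_set_def using A_clopen by blast
  moreover have "closure_preserving X \<A>"
    unfolding closure_preserving_def
  proof (intro allI impI)
    fix \<P> assume P: "\<P> \<subseteq> \<A>"
    have "openin X (topspace X - \<Union>\<P>)"
    proof (subst openin_subopen, intro ballI)
      fix y assume y: "y \<in> topspace X - \<Union>\<P>"
      show "\<exists>T. openin X T \<and> y \<in> T \<and> T \<subseteq> topspace X - \<Union>\<P>"
      proof (cases "y \<in> V")
        case False
        have "\<Union>\<P> \<subseteq> V"
          using P unfolding \<A>_def by blast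
        with False y V(2) show ?thesis
          by (intro exI[of _ "topspace X - V"]) blast
      next
        case True
        then obtain N where N: "openin X N" "y \<in> N" "\<And>U. U \<in> \<U> \<Longrightarrow> y \<in> U \<Longrightarrow> N \<subseteq> U"
          using stable by meson
        have "N \<inter> Q = {}" if "Q \<in> \<P>" for Q
        proof -
          from that P obtain \<S> where S: "\<S> \<subseteq> \<U>" "Q = V - \<Union>\<S>"
            unfolding \<A>_def by blast
          with that y True obtain U where "U \<in> \<S>" "y \<in> U"
            by blast
          with S N(3) show ?thesis
            by blast
        qed
        then have "N \<subseteq> topspace X - \<Union>\<P>"
          using openin_subset[OF N(1)] by blast
        with N show ?thesis
          by blast
      qed
    qed
    moreover have "\<Union>\<P> \<subseteq> topspace X"
      using P A_clopen openin_subset by blast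
    ultimately have "X closure_of (\<Union>\<P>) = \<Union>\<P>"
      by (simp add: closedin_def closure_of_closedin)
    also have "\<dots> = (\<Union>Q\<in>\<P>. X closure_of Q)"
      using P A_clopen by (auto simp: closure_of_closedin subset_iff)
    finally show "X closure_of (\<Union>\<P>) = (\<Union>Q\<in>\<P>. X closure_of Q)" .
  qed
  ultimately show ?thesis
    unfolding s_m1_at_def by blast
qed

section \<open>Finite Cantor--Bendixson derivatives\<close>

definition remove_isolated :: "'a topology \<Rightarrow> 'a set \<Rightarrow> 'a set"
  where "remove_isolated X Z = Z - isolated_points (subtopology X Z)"

lemma remove_isolated_subset: "remove_isolated X Z \<subseteq> Z"
  unfolding remove_isolated_def by blast

text \<open>
  For \<open>S\<close> the set of all isolated points this is closedness of the derivative of \<open>Z\<close>; arbitrary \<open>S\<close>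
  also covers the closedness of all subsets of a closed discrete \<open>Z\<close>.
\<close>

lemma closedin_Diff_if_isolated_subset:
  assumes "closedin X Z" "S \<subseteq> isolated_points (subtopology X Z)"
  shows "closedin X (Z - S)"
proof -
  have "openin (subtopology X Z) (\<Union>x\<in>S. {x})"
    using assms(2) unfolding isolated_points_def by (intro openin_Union) auto
  then have "closedin (subtopology X Z) (topspace (subtopology X Z) - S)"
    by (intro closedin_diff[OF closedin_topspace]) simp
  moreover have "topspace (subtopology X Z) = Z"
    using closedin_subset[OF assms(1)] by auto
  ultimately show ?thesis
    using closedin_trans_full[OF _ assms(1)] by simp
qed

lemma closedin_remove_isolated: "closedin X Z \<Longrightarrow> closedin X (remove_isolated X Z)"
  unfolding remove_isolated_def by (rule closedin_Diff_if_isolated_subset) auto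

lemma neighbourhood_if_notin_remove_isolated:
  assumes "x \<in> Z" "x \<notin> remove_isolated X Z"
  shows "\<exists>W. openin X W \<and> W \<inter> Z = {x}"
proof -
  have "openin (subtopology X Z) {x}"
    using assms unfolding remove_isolated_def isolated_points_def by blast
  then show ?thesis
    unfolding openin_subtopology by metis
qed

lemma finite_Well_order_greatest:
  assumes "Well_order r" "finite (Field r)" "Field r \<noteq> {}"
  obtains m where "greatest_in r m"
proof -
  have lin: "refl_on (Field r) r" "trans r" "antisym r" "total_on (Field r) r"
    using assms(1)
    unfolding well_order_on_def linear_order_on_def partial_order_on_def preorder_on_def by auto
  have "\<exists>m\<in>A. \<forall>a\<in>A. (a, m) \<in> r" if "finite A" "A \<noteq> {}" "A \<subseteq> Field r" for A
    using that
  proof (induction A rule: finite_ne_induct)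
    case (singleton x)
    then show ?case
      using lin(1) by (auto dest: refl_onD)
  next
    case (insert x A)
    then obtain m where m: "m \<in> A" "\<forall>a\<in>A. (a, m) \<in> r"
      by auto
    have "(m, x) \<in> r \<or> (x, m) \<in> r"
      using lin(1,4) insert.prems m(1) unfolding total_on_def
      by (metis insert_subset refl_onD subsetD)
    then show ?case
    proof
      assume "(m, x) \<in> r"
      then have "\<forall>a\<in>insert x A. (a, x) \<in> r"
        using m lin(1,2) insert.prems by (auto dest: refl_onD transD)
      then show ?thesis by blast
    next
      assume "(x, m) \<in> r"
      then show ?thesis using m by blast
    qed
  qed
  from this[of "Field r"] assms(2,3) show thesis
    using that unfolding greatest_in_def by auto
qed

lemma cb_derivative_finite:
  assumes "Well_order r" "finite (Field r)"
  shows "cb_derivative X r = (remove_isolated X ^^ card (Field r)) (topspace X)"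
  using assms
proof (induction "card (Field r)" arbitrary: r)
  case 0
  then show ?case
    by (subst cb_derivative.simps) simp
next
  case (Suc n)
  then have ne: "Field r \<noteq> {}"
    by auto
  obtain m where m: "greatest_in r m"
    using finite_Well_order_greatest Suc.prems ne by metis
  have "underS r m = Field r - {m}"
    using m unfolding greatest_in_def underS_def by (auto simp: Field_def)
  moreover have "Field (Restr r (Field r - {m})) = Field r - {m}"
    using Suc.prems(1) by (intro Refl_Field_Restr2) (auto simp: order_on_defs)
  ultimately have fld: "Field (segment_below r m) = Field r - {m}"
    unfolding segment_below_def by simp
  have "card (Field (segment_below r m)) = n"
    using Suc.hyps(2) Suc.prems(2) m unfolding fld greatest_in_def by simp
  moreover have "Well_order (segment_below r m)"
    unfolding segment_below_def using Suc.prems(1) by (rule Well_order_Restr)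
  ultimately have IH:
    "cb_derivative X (segment_below r m) = (remove_isolated X ^^ n) (topspace X)"
    using Suc.hyps(1)[of "segment_below r m"] Suc.prems(2) fld by simp
  have "cb_derivative X r = remove_isolated X (cb_derivative X (segment_below r m))"
    using Suc.prems(1) ne m greatest_in_the[OF Suc.prems(1) m]
    by (subst cb_derivative.simps) (auto simp: Let_def remove_isolated_def)
  then show ?case
    using IH Suc.hyps(2)[symmetric] by simp
qed

lemma remove_isolated_funpow_antimono:
  "m \<le> n \<Longrightarrow> (remove_isolated X ^^ n) Z \<subseteq> (remove_isolated X ^^ m) Z"
  by (rule lift_Suc_antimono_le) (simp add: remove_isolated_subset)

text \<open>
  A well-order of type at most \<open>n\<close> has at most \<open>n\<close> elements, so no limit step enters its derivative,
  which is an iterate of \<open>remove_isolated\<close>. Since iterates decrease, an index below \<open>n\<close> still makes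
  the \<open>n\<close>-th one empty.
\<close>

lemma funpow_remove_isolated_empty_if_index_le:
  fixes r :: "'o rel"
  assumes "is_dispersion_index X r" "(r, natLeq_on n) \<in> ordLeq"
  shows "(remove_isolated X ^^ n) (topspace X) = {}"
proof -
  have r: "Well_order r" "cb_derivative X r = {}"
    using assms(1) unfolding is_dispersion_index_def by auto
  have "(card_of (Field r), card_of (Field (natLeq_on n))) \<in> ordLeq"
    using assms(2) by (rule card_of_mono2)
  then obtain f where f: "inj_on f (Field r)" "f ` Field r \<subseteq> {x. x < n}"
    unfolding card_of_ordLeq[symmetric] Field_natLeq_on by blast
  then have "finite (Field r)"
    using finite_Collect_less_nat by (metis finite_imageD finite_subset)
  moreover have "card (Field r) \<le> n"
    using card_inj_on_le[OF f] by simp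
  ultimately show ?thesis
    using r cb_derivative_finite[of r X] remove_isolated_funpow_antimono[of "card (Field r)" n X]
    by (metis subset_empty)
qed

section \<open>Compact scattered spaces of dispersion index at most three\<close>

theorem theorem3p2:
  fixes X :: "'a topology" and i :: "'o rel"
  assumes "t1_space X" and "regular_space X"
    and "compact_space X" and "scattered_space X"
    and "is_dispersion_index X i" and "(i, natLeq_on 3) \<in> ordLeq"
  shows "s_m1_space X"
  unfolding s_m1_space_def
proof (intro allI impI)
  fix F assume F: "closedin X F"
  have haus: "Hausdorff_space X"
    using assms(1,2) by (simp add: regular_t1_imp_Hausdorff_space)
  define X1 where "X1 = remove_isolated X (topspace X)"
  define X2 where "X2 = remove_isolated X X1"
  have X3: "remove_isolated X X2 = {}"
    using funpow_remove_isolated_empty_if_index_le[OF assms(5,6)]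
    by (simp add: X1_def X2_def numeral_3_eq_3)
  have X2: "closedin X X2"
    unfolding X1_def X2_def by (intro closedin_remove_isolated) simp
  (* Emptiness of the third derivative says that X2 is discrete, hence all its subsets are closed. *)
  have "closedin X (X2 - F)"
  proof -
    have "X2 \<inter> F \<subseteq> isolated_points (subtopology X X2)"
      using X3 unfolding remove_isolated_def by blast
    from closedin_Diff_if_isolated_subset[OF X2 this] show ?thesis
      by (simp add: Diff_Int)
  qed
  then have "openin X (topspace X - (X2 - F))"
    by blast
  moreover have "F \<subseteq> topspace X - (X2 - F)"
    using closedin_subset[OF F] by blast
  ultimately obtain V where V: "openin X V" "closedin X V" "F \<subseteq> V" "V \<subseteq> topspace X - (X2 - F)"
    using clopen_between_if_compact_scattered[OF assms(3) haus assms(4) F] by metis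
  have "\<exists>U. openin X U \<and> closedin X U \<and> x \<in> U \<and> U \<inter> F = {} \<and> U \<inter> X1 \<subseteq> {x}"
    if x: "x \<in> V - F" for x
  proof -
    have xX: "x \<in> topspace X" "x \<notin> X2"
      using x V(4) by auto
    have "\<exists>W. openin X W \<and> x \<in> W \<and> W \<inter> X1 \<subseteq> {x}"
    proof (cases "x \<in> X1")
      case True
      then obtain W where "openin X W" "W \<inter> X1 = {x}"
        using neighbourhood_if_notin_remove_isolated xX(2) unfolding X2_def by metis
      then show ?thesis
        by blast
    next
      case False
      then obtain W where "openin X W" "W \<inter> topspace X = {x}"
        using neighbourhood_if_notin_remove_isolated xX(1) unfolding X1_def by metis
      moreover have "X1 \<subseteq> topspace X"
        unfolding X1_def by (rule remove_isolated_subset)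
      ultimately show ?thesis
        by blast
    qed
    then obtain W where W: "openin X W" "x \<in> W" "W \<inter> X1 \<subseteq> {x}"
      by blast
    have "closedin X {x}"
      using assms(1) xX(1) by (simp add: closedin_t1_singleton)
    moreover have "openin X (W - F)"
      using W(1) F by blast
    moreover have "{x} \<subseteq> W - F"
      using W(2) x by blast
    ultimately obtain U where "openin X U" "closedin X U" "{x} \<subseteq> U" "U \<subseteq> W - F"
      by (rule clopen_between_if_compact_scattered[OF assms(3) haus assms(4)])
    with W(3) show ?thesis
      by blast
  qed
  then obtain U where U: "\<And>x. x \<in> V - F \<Longrightarrow>
      openin X (U x) \<and> closedin X (U x) \<and> x \<in> U x \<and> U x \<inter> F = {} \<and> U x \<inter> X1 \<subseteq> {x}"
    by metis
  show "s_m1_at X F"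
  proof (rule s_m1_at_if_interior_preserving_cover[OF assms(3) V(1-3)])
    show "V - F \<subseteq> \<Union>(U ` (V - F))"
      using U by blast
  next
    fix y assume y: "y \<in> V"
    show "\<exists>N. openin X N \<and> y \<in> N \<and> (\<forall>B\<in>U ` (V - F). y \<in> B \<longrightarrow> N \<subseteq> B)"
    proof (cases "y \<in> X1")
      case False
      have "y \<in> topspace X"
        using y openin_subset[OF V(1)] by blast
      then obtain W where "openin X W" "W \<inter> topspace X = {y}"
        using False neighbourhood_if_notin_remove_isolated unfolding X1_def by metis
      then have "openin X {y}"
        by (metis inf.absorb1 openin_subset)
      then show ?thesis
        by (intro exI[of _ "{y}"]) auto
    next
      case True
      show ?thesis
      proof (cases "y \<in> F")
        case True
        then have "\<forall>B\<in>U ` (V - F). y \<notin> B"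
          using U by blast
        then show ?thesis
          using V(1) y by blast
      next
        case False
        have "x = y" if "x \<in> V - F" "y \<in> U x" for x
          using U[OF that(1)] that(2) True by blast
        then show ?thesis
          using U[of y] y False by (intro exI[of _ "U y"]) auto
      qed
    qed
  qed (use U in auto)
qed

end
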